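(* Let $n,m,l\ge 1$ and $N\ge 0$ be integers, let $A\in\mathbb{R}^{n\times n}$, $B,E\in\mathbb{R}^{n\times m}$, $c_o\in\mathbb{R}^{l\times n}$, $Q=c_o'c_o$, and let $R,P_{N+1}\in\mathbb{R}^{n\times n}$ be symmetric positive semi-definite. Let $r\in\mathbb{R}^n$, let $d_0,\dots,d_N\in\mathbb{R}^m$ be a known disturbance sequence, and let $x_0\in\mathbb{R}^n$ be the initial state. Consider $$x_{k+1}=Ax_k+Bu_k+Ed_k,\qquad k=0,1,\dots,N,$$ and the cost $$J_N=\sum_{k=0}^{N}\Big[(x_k-r)'Q(x_k-r)+(Bu_k+Ed_k)'R(Bu_k+Ed_k)\Big]+(x_{N+1}-r)'P_{N+1}(x_{N+1}-r).$$ Define backward in $k=N,N-1,\dots,0$, starting from $P_{N+1}$, $$\Upsilon_k=B'(R+P_{k+1})B,\qquad M_k=B'P_{k+1}A,\qquad P_k=Q+A'P_{k+1}A-M_k'\Upsilon_k^{-1}M_k .$$ Then there exists a unique control sequence $u_0,\dots,u_N\in\mathbb{R}^m$ minimizing $J_N$ if and only if $\Upsilon_k>0$ for all $k=0,1,\dots,N$. In this case, the optimal controller is $$u_k=-\Upsilon_k^{-1}M_kx_k-\Upsilon_k^{-1}h_k,\qquad k=0,\dots,N,$$ where $h_k$ (together with $f_k$) is given by the backward equations, for $k=N,\dots,0$, $$h_k=B'(R+P_{k+1})Ed_k+B'f_{k+1},$$ $$f_k=A'P_{k+1}Ed_k+A'f_{k+1}-M_k'\Upsilon_k^{-1}h_k-Qr,\qquad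 f_{N+1}=-P_{N+1}r;$$ the optimal value of the cost is $$J_N=x_0'P_0x_0+2x_0'f_0+r'P_{N+1}r+\sum_{k=0}^{N}\Big[r'Qr+d_k'E'(R+P_{k+1})Ed_k+2d_k'E'f_{k+1}-h_k'\Upsilon_k^{-1}h_k\Big];$$ and the state $x_k$ and the co-state $\lambda_k$ are related by $$\lambda_{k-1}=P_kx_k+f_k,\qquad k=0,\dots,N,$$ where $(x_k,u_k,\lambda_k)$ is the solution of the forward-backward difference equations $$0=B'RBu_k+B'\lambda_k+B'REd_k,\quad \lambda_{k-1}=Q(x_k-r)+A'\lambda_k,\quad x_{k+1}=Ax_k+Bu_k+Ed_k,\quad \lambda_N=P_{N+1}(x_{N+1}-r),$$ for $k=0,\dots,N$ with the given $x_0$.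
   Context: A prime $'$ denotes transpose. For a symmetric matrix, $M>0$ means positive definite. The control sequence $u_0,\dots,u_N$ is unconstrained. The backward recursion for $P_k$ uses $\Upsilon_k^{-1}$, so the condition "$\Upsilon_k>0$ for all $k=0,\dots,N$" is understood recursively: starting at $k=N$, each $\Upsilon_k$ is defined and positive definite, which allows the next step of the recursion. No matching condition between $B$ and $E$ (such as $B\Gamma=E$ for some $\Gamma$) is imposed. *)

theory Defs
  imports "HOL-Analysis.Analysis"
begin

definition pos_semidef :: "real^'n^'n \<Rightarrow> bool" where
  "pos_semidef M \<longleftrightarrow> transpose M = M \<and> (\<forall>x. 0 \<le> x \<bullet> (M *v x))"

definition pos_def :: "real^'n^'n \<Rightarrow> bool" where
  "pos_def M \<longleftrightarrow> transpose M = M \<and> (\<forall>x. x \<noteq> 0 \<longrightarrow> 0 < x \<bullet> (M *v x))"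

primrec state ::
  "real^'n^'n \<Rightarrow> real^'m^'n \<Rightarrow> real^'m^'n \<Rightarrow> (nat \<Rightarrow> real^'m) \<Rightarrow> real^'n \<Rightarrow>
   (nat \<Rightarrow> real^'m) \<Rightarrow> nat \<Rightarrow> real^'n" where
  "state A B E d x0 u 0 = x0"
| "state A B E d x0 u (Suc k) = A *v state A B E d x0 u k + B *v u k + E *v d k"

definition cost ::
  "nat \<Rightarrow> real^'n^'n \<Rightarrow> real^'m^'n \<Rightarrow> real^'m^'n \<Rightarrow> real^'n^'n \<Rightarrow> real^'n^'n \<Rightarrow> real^'n^'n \<Rightarrow>
   real^'n \<Rightarrow> (nat \<Rightarrow> real^'m) \<Rightarrow> real^'n \<Rightarrow> (nat \<Rightarrow> real^'m) \<Rightarrow> real" where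
  "cost N A B E Q R PT r d x0 u =
     (let x = state A B E d x0 u in
       (\<Sum>k=0..N. (x k - r) \<bullet> (Q *v (x k - r))
                 + (B *v u k + E *v d k) \<bullet> (R *v (B *v u k + E *v d k)))
       + (x (N + 1) - r) \<bullet> (PT *v (x (N + 1) - r)))"

text \<open>Only the entries \<open>0..N\<close> of a control matter.  Requiring the value \<open>undefined\<close> elsewhere
  makes the functions below correspond bijectively to the sequences \<open>u\<^sub>0, \<dots>, u\<^sub>N\<close>,
  so that uniqueness can be expressed by equality of functions.\<close>

definition controls :: "nat \<Rightarrow> (nat \<Rightarrow> real^'m) set" where
  "controls N = {0..N} \<rightarrow>\<^sub>E UNIV"

text \<open>The co-state sequence \<open>\<lambda>\<close> starts at index \<open>-1\<close> and is therefore indexed by integers;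
  only \<open>x\<^sub>0, \<dots>, x\<^bsub>N+1\<^esub>\<close>, \<open>u\<^sub>0, \<dots>, u\<^sub>N\<close> and \<open>\<lambda>\<^bsub>-1\<^esub>, \<dots>, \<lambda>\<^sub>N\<close> are constrained.\<close>

definition fbde_solution ::
  "nat \<Rightarrow> real^'n^'n \<Rightarrow> real^'m^'n \<Rightarrow> real^'m^'n \<Rightarrow> real^'n^'n \<Rightarrow> real^'n^'n \<Rightarrow> real^'n^'n \<Rightarrow>
   real^'n \<Rightarrow> (nat \<Rightarrow> real^'m) \<Rightarrow> real^'n \<Rightarrow>
   (nat \<Rightarrow> real^'n) \<Rightarrow> (nat \<Rightarrow> real^'m) \<Rightarrow> (int \<Rightarrow> real^'n) \<Rightarrow> bool" where
  "fbde_solution N A B E Q R PT r d x0 x u lam \<longleftrightarrow>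
     x 0 = x0 \<and>
     lam (int N) = PT *v (x (N + 1) - r) \<and>
     (\<forall>k\<in>{0..N}.
        0 = (transpose B ** R ** B) *v u k + transpose B *v lam (int k)
            + (transpose B ** R ** E) *v d k \<and>
        lam (int k - 1) = Q *v (x k - r) + transpose A *v lam (int k) \<and>
        x (k + 1) = A *v x k + B *v u k + E *v d k)"

end

theory Submission
  imports Defs
begin

text \<open>Completing the square one step at a time, backward from the horizon, turns the cost into a
  constant plus \<open>\<Sum> (u\<^sub>k - F\<^sub>k x\<^sub>k) \<bullet> \<Upsilon>\<^sub>k (u\<^sub>k - F\<^sub>k x\<^sub>k)\<close>, where \<open>F\<^sub>k\<close> is the affine feedback. If every
  \<open>\<Upsilon>\<^sub>k\<close> is positive definite, the minimizer is the closed-loop control and nothing else; the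
  forward-backward equations, solved backward for the co-state, force the same feedback.

  Conversely, the parallelogram law \<open>J (u + v) + J (u - v) = 2 J u + 2 J\<^sub>0 v\<close>, with \<open>J\<^sub>0\<close> the
  homogeneous cost (\<open>r = 0\<close>, \<open>d = 0\<close>, \<open>x\<^sub>0 = 0\<close>), shows that a unique minimizer \<open>u\<close> forces
  \<open>J\<^sub>0 v > 0\<close> for \<open>v \<noteq> 0\<close>. If \<open>\<Upsilon>\<^sub>j\<close> is positive definite for all \<open>j > k\<close>, a suitable \<open>v\<close> with
  \<open>v\<^sub>k = w\<close> has \<open>J\<^sub>0 v = w \<bullet> \<Upsilon>\<^sub>k w\<close>, so \<open>\<Upsilon>\<^sub>k\<close> is positive definite as well.\<close>

section \<open>Transposes, quadratic forms and inverses\<close>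

text \<open>As a simp rule it would turn \<open>transpose A *v x\<close> into a vector-matrix
  product and hide the pattern of \<open>inner_transpose_vector\<close>.\<close>

declare transpose_matrix_vector [simp del]

lemma inner_transpose_vector: "x \<bullet> (transpose A *v y) = (A *v x) \<bullet> (y :: real^'n)"
  by (simp add: dot_lmul_matrix[symmetric] transpose_matrix_vector inner_commute)

lemma inner_symmetric_matrix:
  fixes S :: "real^'n^'n"
  assumes "transpose S = S"
  shows "x \<bullet> (S *v y) = y \<bullet> (S *v x)"
  by (metis assms inner_commute inner_transpose_vector)

lemma transpose_add: "transpose (A + B) = transpose A + transpose (B :: 'a::plus^'n^'m)"
  by (simp add: transpose_def vec_eq_iff)

lemma transpose_diff: "transpose (A - B) = transpose A - transpose (B :: 'a::minus^'n^'m)"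
  by (simp add: transpose_def vec_eq_iff)

lemma matrix_vector_mult_minus: "A *v (- x) = - (A *v x)" for A :: "real^'n^'m"
  using matrix_vector_mult_diff_distrib[of A 0 x] by simp

text \<open>Unfolds matrix products and sums into nested applications and moves transposes across
  inner products, so that identities of quadratic forms become polynomial.\<close>

lemmas matrix_vector_simps = matrix_vector_mult_minus
  matrix_vector_mul_assoc[symmetric] matrix_vector_mult_add_rdistrib matrix_vector_mult_diff_rdistrib
  matrix_vector_right_distrib matrix_vector_mult_diff_distrib inner_transpose_vector

lemma parallelogram_quadratic_form:
  fixes S :: "real^'n^'n"
  shows "(a + b) \<bullet> (S *v (a + b)) + (a - b) \<bullet> (S *v (a - b))
    = 2 * (a \<bullet> (S *v a)) + 2 * (b \<bullet> (S *v b))"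
  by (simp add: matrix_vector_simps algebra_simps)

text \<open>Definiteness makes \<open>Y\<close> injective, hence invertible in finite dimension. As
  \<open>Y\<close> is symmetric, the transposed inverse is again a left inverse, so it is the
  inverse.\<close>

lemma pos_def_matrix_inv:
  fixes Y :: "real^'n^'n"
  assumes "pos_def Y"
  shows "Y ** matrix_inv Y = mat 1" "matrix_inv Y ** Y = mat 1"
    "transpose (matrix_inv Y) = matrix_inv Y"
proof -
  have "inj ((*v) Y)"
  proof (rule injI)
    fix x y assume "Y *v x = Y *v y"
    then have "(x - y) \<bullet> (Y *v (x - y)) = 0"
      by (simp add: matrix_vector_mult_diff_distrib)
    then show "x = y"
      using assms unfolding pos_def_def by (metis less_irrefl right_minus_eq)
  qed
  then have inv: "invertible Y"
    by (metis invertible_left_inverse matrix_left_invertible_injective)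
  show 1: "Y ** matrix_inv Y = mat 1" and 2: "matrix_inv Y ** Y = mat 1"
    using someI_ex[OF inv[unfolded invertible_def]] unfolding matrix_inv_def by auto
  have "transpose (matrix_inv Y) ** Y = mat 1"
    using arg_cong[OF 1, of transpose] assms
    by (simp add: matrix_transpose_mul transpose_mat pos_def_def)
  then show "transpose (matrix_inv Y) = matrix_inv Y"
    by (metis 1 matrix_mul_assoc matrix_mul_lid matrix_mul_rid)
qed

lemma pos_def_matrix_inv_vector:
  assumes "pos_def Y"
  shows "Y *v (matrix_inv Y *v x) = x" "matrix_inv Y *v (Y *v x) = x"
  using pos_def_matrix_inv[OF assms] by (simp_all add: matrix_vector_mul_assoc)

lemma pos_def_quadratic_eq_0_iff:
  assumes "pos_def Y"
  shows "x \<bullet> (Y *v x) = 0 \<longleftrightarrow> x = 0"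
  using assms unfolding pos_def_def by force

lemma pos_def_quadratic_nonneg:
  assumes "pos_def Y"
  shows "0 \<le> x \<bullet> (Y *v x)"
  using assms unfolding pos_def_def by (cases "x = 0") (auto intro: less_imp_le)

section \<open>Completing the square in one time step\<close>

lemma complete_square:
  fixes Y :: "real^'m^'m"
  assumes "pos_def Y"
  shows "u \<bullet> (Y *v u) + 2 * (u \<bullet> g)
    = (u + matrix_inv Y *v g) \<bullet> (Y *v (u + matrix_inv Y *v g)) - g \<bullet> (matrix_inv Y *v g)"
proof -
  have "transpose Y = Y"
    using assms by (simp add: pos_def_def)
  then have "(matrix_inv Y *v g) \<bullet> (Y *v u) = u \<bullet> g"
    by (metis inner_symmetric_matrix assms pos_def_matrix_inv_vector(1))
  then show ?thesis
    by (simp add: matrix_vector_right_distrib inner_add_left inner_add_right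
        pos_def_matrix_inv_vector[OF assms] inner_commute)
qed

text \<open>The recursions for \<open>P'\<close> and \<open>f'\<close> collect exactly the
  \<open>x\<close>-dependent terms left over once the square in \<open>u\<close> is split off; the
  parenthesis keeps what is free of \<open>x\<close> and \<open>u\<close>.\<close>

lemma bellman_step:
  fixes A Q R P P' :: "real^'n^'n" and B E :: "real^'m^'n" and M :: "real^'n^'m"
  assumes Q: "transpose Q = Q" and R: "transpose R = R" and P: "transpose P = P"
    and pd: "pos_def Y"
    and Y: "Y = transpose B ** (R + P) ** B"
    and M: "M = transpose B ** P ** A"
    and P': "P' = Q + transpose A ** P ** A - transpose M ** matrix_inv Y ** M"
    and h: "h = (transpose B ** (R + P) ** E) *v d + transpose B *v f"
    and f': "f' = (transpose A ** P ** E) *v d + transpose A *v f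
                 - (transpose M ** matrix_inv Y) *v h - Q *v r"
    and w: "w = B *v u + E *v d" and y: "y = A *v x + B *v u + E *v d"
    and z: "z = u + matrix_inv Y *v (M *v x + h)"
  shows "(x - r) \<bullet> (Q *v (x - r)) + w \<bullet> (R *v w) + (y \<bullet> (P *v y) + 2 * (y \<bullet> f))
    = x \<bullet> (P' *v x) + 2 * (x \<bullet> f')
      + (r \<bullet> (Q *v r) + d \<bullet> ((transpose E ** (R + P) ** E) *v d)
         + 2 * (d \<bullet> (transpose E *v f)) - h \<bullet> (matrix_inv Y *v h))
      + z \<bullet> (Y *v z)"
proof -
  \<comment> \<open>As a polynomial in \<open>u\<close> the left side has quadratic part
    \<open>Y\<close> and linear part \<open>2 * (u \<bullet> g)\<close>.\<close>
  define g where "g = M *v x + h"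
  define a b e where "a = A *v x" and "b = B *v u" and "e = E *v d"
  \<comment> \<open>The expansion produces mixed products in both orders, which these instances
    identify.\<close>
  note sym = inner_symmetric_matrix[OF Q, of r x]
    inner_symmetric_matrix[OF P, of a b] inner_symmetric_matrix[OF P, of a e]
    inner_symmetric_matrix[OF P, of b e] inner_symmetric_matrix[OF R, of b e]
  have zz: "z \<bullet> (Y *v z) = u \<bullet> (Y *v u) + 2 * (u \<bullet> g) + g \<bullet> (matrix_inv Y *v g)"
    unfolding z using complete_square[OF pd, of u g] by (simp add: g_def)
  have uY: "u \<bullet> (Y *v u) = b \<bullet> (R *v b) + b \<bullet> (P *v b)"
    by (simp add: Y matrix_vector_simps b_def inner_add_right)
  have ug: "u \<bullet> g = b \<bullet> (P *v a) + b \<bullet> (R *v e) + b \<bullet> (P *v e) + b \<bullet> f"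
    by (simp add: g_def M h matrix_vector_simps a_def b_def e_def inner_add_right)
  have gg: "g \<bullet> (matrix_inv Y *v g) = (M *v x) \<bullet> (matrix_inv Y *v (M *v x))
      + 2 * ((M *v x) \<bullet> (matrix_inv Y *v h)) + h \<bullet> (matrix_inv Y *v h)"
    using inner_symmetric_matrix[OF pos_def_matrix_inv(3)[OF pd], of "M *v x" h]
    by (simp add: g_def matrix_vector_right_distrib inner_add_left inner_add_right)
  have xP: "x \<bullet> (P' *v x) = x \<bullet> (Q *v x) + a \<bullet> (P *v a) - (M *v x) \<bullet> (matrix_inv Y *v (M *v x))"
    by (simp add: P' matrix_vector_simps a_def inner_add_right inner_diff_right)
  have xf: "x \<bullet> f' = a \<bullet> (P *v e) + a \<bullet> f - (M *v x) \<bullet> (matrix_inv Y *v h) - x \<bullet> (Q *v r)"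
    by (simp add: f' matrix_vector_simps a_def e_def inner_add_right inner_diff_right)
  have dd: "d \<bullet> ((transpose E ** (R + P) ** E) *v d) = e \<bullet> (R *v e) + e \<bullet> (P *v e)"
    "d \<bullet> (transpose E *v f) = e \<bullet> f"
    by (simp_all add: matrix_vector_simps e_def inner_add_right)
  show ?thesis
    unfolding zz uY ug gg xP xf dd w y a_def[symmetric] b_def[symmetric] e_def[symmetric]
    using sym by (simp add: matrix_vector_simps algebra_simps)
qed

section \<open>Trajectories and feedback laws\<close>

lemma state_cong:
  assumes "\<And>j. j < k \<Longrightarrow> u j = v j"
  shows "state A B E d x0 u k = state A B E d x0 v k"
  using assms by (induction k) auto

lemma cost_cong:
  assumes "\<And>k. k \<le> N \<Longrightarrow> u k = v k"
  shows "cost N A B E Q R PT r d x0 u = cost N A B E Q R PT r d x0 v"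
proof -
  have "state A B E d x0 u k = state A B E d x0 v k" if "k \<le> N + 1" for k
    using that assms by (intro state_cong) auto
  then show ?thesis
    using assms by (auto simp: cost_def Let_def intro!: sum.cong)
qed

text \<open>The equation is implicit, since the state depends on \<open>u\<close>. Running the
  closed loop first gives \<open>y\<close>, from which the control is read off.\<close>

lemma state_feedback_exists: "\<exists>u. \<forall>k. u k = F k (state A B E d x0 u k)"
proof -
  define y where "y = rec_nat x0 (\<lambda>k x. A *v x + B *v F k x + E *v d k)"
  have "state A B E d x0 (\<lambda>k. F k (y k)) k = y k" for k
    by (induction k) (simp_all add: y_def)
  then show ?thesis
    by metis
qed

text \<open>By causality, controls that agree before time \<open>k\<close> reach the same state at
  \<open>k\<close>, and the law then returns the same value.\<close>

lemma feedback_unique: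
  assumes "\<And>k. k \<le> N \<Longrightarrow> u k = F k (state A B E d x0 u k)"
    and "\<And>k. k \<le> N \<Longrightarrow> v k = F k (state A B E d x0 v k)"
  shows "k \<le> N \<Longrightarrow> u k = v k"
proof (induction k rule: less_induct)
  case (less k)
  then have "state A B E d x0 u k = state A B E d x0 v k"
    by (intro state_cong) auto
  then show ?case
    using assms less.prems by metis
qed

section \<open>Parallelogram law for the cost\<close>

lemma state_add_diff:
  "state A B E d x0 (\<lambda>k. u k + v k) k
     = state A B E d x0 u k + state A B E (\<lambda>_. 0) 0 v k"
  "state A B E d x0 (\<lambda>k. u k - v k) k
     = state A B E d x0 u k - state A B E (\<lambda>_. 0) 0 v k"
  by (induction k) (simp_all add: matrix_vector_right_distrib matrix_vector_mult_diff_distrib)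

lemma cost_parallelogram:
  "cost N A B E Q R PT r d x0 (\<lambda>k. u k + v k) + cost N A B E Q R PT r d x0 (\<lambda>k. u k - v k)
   = 2 * cost N A B E Q R PT r d x0 u + 2 * cost N A B E Q R PT 0 (\<lambda>_. 0) 0 v"
proof -
  let ?x = "\<lambda>k. state A B E d x0 u k - r" and ?y = "state A B E (\<lambda>_. 0) 0 v"
  let ?w = "\<lambda>k. B *v u k + E *v d k" and ?b = "\<lambda>k. B *v v k"
  \<comment> \<open>Adds the identities for the \<open>Q\<close> and \<open>R\<close> terms of a
    stage while keeping the quadratic forms opaque.\<close>
  have combine: "p + p' + (q + q') = 2 * (s + s') + 2 * (t + t')"
    if "p + q = 2 * s + 2 * t" "p' + q' = 2 * s' + 2 * t'" for p p' q q' s s' t t' :: real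
    using that by simp
  have x: "state A B E d x0 (\<lambda>k. u k + v k) k - r = ?x k + ?y k"
    "state A B E d x0 (\<lambda>k. u k - v k) k - r = ?x k - ?y k" for k
    by (simp_all add: state_add_diff)
  have w: "B *v (u k + v k) + E *v d k = ?w k + ?b k"
    "B *v (u k - v k) + E *v d k = ?w k - ?b k" for k
    by (simp_all add: matrix_vector_simps)
  have "cost N A B E Q R PT r d x0 (\<lambda>k. u k + v k)
      = (\<Sum>k=0..N. (?x k + ?y k) \<bullet> (Q *v (?x k + ?y k)) + (?w k + ?b k) \<bullet> (R *v (?w k + ?b k)))
        + (?x (N+1) + ?y (N+1)) \<bullet> (PT *v (?x (N+1) + ?y (N+1)))"
    by (simp only: cost_def Let_def x w)
  moreover have "cost N A B E Q R PT r d x0 (\<lambda>k. u k - v k)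
      = (\<Sum>k=0..N. (?x k - ?y k) \<bullet> (Q *v (?x k - ?y k)) + (?w k - ?b k) \<bullet> (R *v (?w k - ?b k)))
        + (?x (N+1) - ?y (N+1)) \<bullet> (PT *v (?x (N+1) - ?y (N+1)))"
    by (simp only: cost_def Let_def x w)
  moreover have "cost N A B E Q R PT r d x0 u
      = (\<Sum>k=0..N. ?x k \<bullet> (Q *v ?x k) + ?w k \<bullet> (R *v ?w k)) + ?x (N+1) \<bullet> (PT *v ?x (N+1))"
    by (simp add: cost_def Let_def)
  moreover have "cost N A B E Q R PT 0 (\<lambda>_. 0) 0 v
      = (\<Sum>k=0..N. ?y k \<bullet> (Q *v ?y k) + ?b k \<bullet> (R *v ?b k)) + ?y (N+1) \<bullet> (PT *v ?y (N+1))"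
    by (simp add: cost_def Let_def)
  moreover have "(\<Sum>k=0..N. (?x k + ?y k) \<bullet> (Q *v (?x k + ?y k)) + (?w k + ?b k) \<bullet> (R *v (?w k + ?b k)))
      + (\<Sum>k=0..N. (?x k - ?y k) \<bullet> (Q *v (?x k - ?y k)) + (?w k - ?b k) \<bullet> (R *v (?w k - ?b k)))
      = 2 * (\<Sum>k=0..N. ?x k \<bullet> (Q *v ?x k) + ?w k \<bullet> (R *v ?w k))
      + 2 * (\<Sum>k=0..N. ?y k \<bullet> (Q *v ?y k) + ?b k \<bullet> (R *v ?b k))"
    unfolding sum.distrib[symmetric] sum_distrib_left
  proof (rule sum.cong[OF refl])
    fix k
    show "(?x k + ?y k) \<bullet> (Q *v (?x k + ?y k)) + (?w k + ?b k) \<bullet> (R *v (?w k + ?b k))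
      + ((?x k - ?y k) \<bullet> (Q *v (?x k - ?y k)) + (?w k - ?b k) \<bullet> (R *v (?w k - ?b k)))
      = 2 * (?x k \<bullet> (Q *v ?x k) + ?w k \<bullet> (R *v ?w k))
      + 2 * (?y k \<bullet> (Q *v ?y k) + ?b k \<bullet> (R *v ?b k))"
      by (rule combine[OF parallelogram_quadratic_form parallelogram_quadratic_form])
  qed
  moreover note parallelogram_quadratic_form[of "?x (N+1)" "?y (N+1)" PT]
  ultimately show ?thesis
    by linarith
qed

text \<open>Both \<open>u + v\<close> and \<open>u - v\<close> differ from the minimizer
  \<open>u\<close> at time \<open>k\<close> and so cost strictly more; the parallelogram law turns
  this gap into the homogeneous cost.\<close>

lemma unique_minimizer_imp_homogeneous_cost_pos:
  assumes uniq: "\<exists>!u. is_arg_min (cost N A B E Q R PT r d x0) (\<lambda>u. u \<in> controls N) u"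
    and v: "k \<le> N" "v k \<noteq> 0"
  shows "0 < cost N A B E Q R PT 0 (\<lambda>_. 0) 0 v"
proof -
  let ?J = "cost N A B E Q R PT r d x0"
  obtain u where u: "is_arg_min ?J (\<lambda>u. u \<in> controls N) u"
    and u': "\<And>u'. is_arg_min ?J (\<lambda>u. u \<in> controls N) u' \<Longrightarrow> u' = u"
    using uniq by auto
  have less: "?J u < ?J w" if "w k \<noteq> u k" for w
  proof -
    \<comment> \<open>Minimality compares only members of \<open>controls N\<close>; restriction
      enters that set without changing the cost or the value at \<open>k\<close>.\<close>
    let ?w = "restrict w {0..N}"
    have "?J ?w = ?J w"
      by (rule cost_cong) simp
    moreover have w: "?w \<in> controls N"
      by (simp add: controls_def)
    moreover have "?w \<noteq> u"
      using that \<open>k \<le> N\<close> by (metis atLeastAtMost_iff le0 restrict_apply')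
    ultimately show ?thesis
      using u u'[of ?w] unfolding is_arg_min_linorder by fastforce
  qed
  have "?J u < ?J (\<lambda>k. u k + v k)" "?J u < ?J (\<lambda>k. u k - v k)"
    using v by (auto intro!: less)
  then show ?thesis
    using cost_parallelogram[of N A B E Q R PT r d x0 u v] by linarith
qed

section \<open>Riccati recursion\<close>

text \<open>\<open>matrix_inv\<close> is total, so \<open>P k\<close> exists even for singular
  \<open>Y k\<close>; definiteness is therefore demanded separately, for the later indices that a
  fact relies on.\<close>

locale riccati =
  fixes A :: "real^'n^'n" and B :: "real^'m^'n" and Q R :: "real^'n^'n" and N :: nat
    and P :: "nat \<Rightarrow> real^'n^'n" and Y :: "nat \<Rightarrow> real^'m^'m" and M :: "nat \<Rightarrow> real^'n^'m"
  assumes Q_sym: "transpose Q = Q" and R_sym: "transpose R = R"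
    and PT_sym: "transpose (P (Suc N)) = P (Suc N)"
    and Y_eq: "\<And>k. k \<le> N \<Longrightarrow> Y k = transpose B ** (R + P (Suc k)) ** B"
    and M_eq: "\<And>k. k \<le> N \<Longrightarrow> M k = transpose B ** P (Suc k) ** A"
    and P_eq: "\<And>k. k \<le> N \<Longrightarrow>
      P k = Q + transpose A ** P (Suc k) ** A - transpose (M k) ** matrix_inv (Y k) ** M k"
begin

lemma P_sym:
  assumes "k \<le> Suc N" and "\<And>j. k \<le> j \<Longrightarrow> j \<le> N \<Longrightarrow> pos_def (Y j)"
  shows "transpose (P k) = P k"
  using assms
proof (induction k rule: inc_induct)
  case base
  show ?case by (rule PT_sym)
next
  case (step k)
  then have "transpose (P (Suc k)) = P (Suc k)"
    by simp
  moreover have "k \<le> N" "pos_def (Y k)"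
    using step by simp_all
  ultimately show ?case
    by (simp add: P_eq Q_sym transpose_add transpose_diff matrix_transpose_mul matrix_mul_assoc
        pos_def_matrix_inv(3))
qed

end

section \<open>Cost-to-go of the tracking problem\<close>

text \<open>The tracking data are kept apart so that the same Riccati data can also be used with
  \<open>r\<close>, \<open>d\<close>, \<open>h\<close>, \<open>f\<close> all zero.\<close>

locale lq_tracking = riccati A B Q R N P Y M
  for A :: "real^'n^'n" and B :: "real^'m^'n" and Q R N P Y M +
  fixes E :: "real^'m^'n" and r :: "real^'n" and d :: "nat \<Rightarrow> real^'m"
    and h :: "nat \<Rightarrow> real^'m" and f :: "nat \<Rightarrow> real^'n"
  assumes fT_eq: "f (Suc N) = - (P (Suc N) *v r)"
    and h_eq: "\<And>k. k \<le> N \<Longrightarrow>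
      h k = (transpose B ** (R + P (Suc k)) ** E) *v d k + transpose B *v f (Suc k)"
    and f_eq: "\<And>k. k \<le> N \<Longrightarrow>
      f k = (transpose A ** P (Suc k) ** E) *v d k + transpose A *v f (Suc k)
            - (transpose (M k) ** matrix_inv (Y k)) *v h k - Q *v r"
begin

definition feedback :: "nat \<Rightarrow> real^'n \<Rightarrow> real^'m" where
  "feedback k x = - (matrix_inv (Y k) *v (M k *v x + h k))"

definition residual :: "nat \<Rightarrow> real^'n \<Rightarrow> real^'m \<Rightarrow> real" where
  "residual k x v = (v - feedback k x) \<bullet> (Y k *v (v - feedback k x))"

definition stage :: "nat \<Rightarrow> real^'n \<Rightarrow> real^'m \<Rightarrow> real" where
  "stage k x v = (x - r) \<bullet> (Q *v (x - r)) + (B *v v + E *v d k) \<bullet> (R *v (B *v v + E *v d k))"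

definition offset :: "nat \<Rightarrow> real" where
  "offset k = r \<bullet> (Q *v r) + d k \<bullet> ((transpose E ** (R + P (Suc k)) ** E) *v d k)
     + 2 * (d k \<bullet> (transpose E *v f (Suc k))) - h k \<bullet> (matrix_inv (Y k) *v h k)"

text \<open>The candidate optimal cost-to-go without its state-independent part, which
  \<open>offset\<close> and the terminal constant account for.\<close>

definition val :: "nat \<Rightarrow> real^'n \<Rightarrow> real" where
  "val k x = x \<bullet> (P k *v x) + 2 * (x \<bullet> f k)"

abbreviation "J x0 \<equiv> cost N A B E Q R (P (Suc N)) r d x0"

lemma terminal_cost:
  "(x - r) \<bullet> (P (Suc N) *v (x - r)) = val (Suc N) x + r \<bullet> (P (Suc N) *v r)"
  using inner_symmetric_matrix[OF PT_sym, of r x]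
  by (simp add: val_def fT_eq matrix_vector_simps algebra_simps)

lemma J_eq:
  "J x0 u = (\<Sum>k=0..N. stage k (state A B E d x0 u k) (u k))
     + val (Suc N) (state A B E d x0 u (Suc N)) + r \<bullet> (P (Suc N) *v r)"
  unfolding cost_def Let_def stage_def Suc_eq_plus1[symmetric] terminal_cost by simp

lemma stage_plus_val:
  assumes k: "k \<le> N" and pd: "\<And>j. k \<le> j \<Longrightarrow> j \<le> N \<Longrightarrow> pos_def (Y j)"
  shows "stage k x v + val (Suc k) (A *v x + B *v v + E *v d k)
    = val k x + offset k + residual k x v"
proof -
  have "transpose (P (Suc k)) = P (Suc k)"
    using assms by (intro P_sym) auto
  from bellman_step[OF Q_sym R_sym this pd[OF order_refl k] Y_eq[OF k] M_eq[OF k] P_eq[OF k]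
      h_eq[OF k] f_eq[OF k] refl refl refl, where u = v and x = x]
  show ?thesis
    by (simp add: stage_def val_def offset_def residual_def feedback_def algebra_simps)
qed

text \<open>\<open>stage_plus_val\<close> telescopes. The start \<open>j\<close> is free because the
  converse needs tails on which only the later \<open>Y k\<close> are known to be definite.\<close>

lemma tail_cost:
  assumes "j \<le> Suc N" and "\<And>k. j \<le> k \<Longrightarrow> k \<le> N \<Longrightarrow> pos_def (Y k)"
  shows "(\<Sum>k=j..N. stage k (state A B E d x0 u k) (u k)) + val (Suc N) (state A B E d x0 u (Suc N))
    = val j (state A B E d x0 u j)
      + (\<Sum>k=j..N. offset k + residual k (state A B E d x0 u k) (u k))"
  using assms
proof (induction j rule: inc_induct)
  case base
  show ?case by simp
next
  case (step j)
  have "{j..N} = insert j {Suc j..N}"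
    using step by auto
  moreover have "stage j (state A B E d x0 u j) (u j) + val (Suc j) (state A B E d x0 u (Suc j))
    = val j (state A B E d x0 u j) + offset j + residual j (state A B E d x0 u j) (u j)"
    using stage_plus_val[of j "state A B E d x0 u j" "u j"] step by simp
  moreover note step.IH
  ultimately show ?case
    using step by simp
qed

section \<open>Optimality of the feedback when all pivots are definite\<close>

context
  assumes pd: "\<And>k. k \<le> N \<Longrightarrow> pos_def (Y k)"
begin

lemma J_completed_squares:
  "J x0 u = x0 \<bullet> (P 0 *v x0) + 2 * (x0 \<bullet> f 0) + r \<bullet> (P (Suc N) *v r) + (\<Sum>k=0..N. offset k)
    + (\<Sum>k=0..N. residual k (state A B E d x0 u k) (u k))"
  unfolding J_eq using tail_cost[of 0 x0 u] pd by (simp add: val_def sum.distrib)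

lemma residual_nonneg: "k \<le> N \<Longrightarrow> 0 \<le> residual k x v"
  unfolding residual_def by (rule pos_def_quadratic_nonneg) (rule pd)

lemma residual_eq_0_iff: "k \<le> N \<Longrightarrow> residual k x v = 0 \<longleftrightarrow> v = feedback k x"
  unfolding residual_def by (simp add: pos_def_quadratic_eq_0_iff pd)

lemma optimal_feedback_exists:
  "\<exists>u\<in>controls N. \<forall>k\<le>N. u k = feedback k (state A B E d x0 u k)"
proof -
  obtain u where u: "\<And>k. u k = feedback k (state A B E d x0 u k)"
    using state_feedback_exists by metis
  have "state A B E d x0 (restrict u {0..N}) k = state A B E d x0 u k" if "k \<le> N" for k
    using that by (intro state_cong) auto
  then have "\<forall>k\<le>N. restrict u {0..N} k = feedback k (state A B E d x0 (restrict u {0..N}) k)"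
    using u by simp
  then show ?thesis
    by (intro bexI[of _ "restrict u {0..N}"]) (auto simp: controls_def)
qed

text \<open>Only the residual sum in \<open>J_completed_squares\<close> depends on \<open>u\<close>.
  It is nonnegative and some admissible control attains zero, so the minimizers are its
  zeros.\<close>

lemma is_arg_min_iff_feedback:
  "is_arg_min (J x0) (\<lambda>u. u \<in> controls N) u
    \<longleftrightarrow> u \<in> controls N \<and> (\<forall>k\<le>N. u k = feedback k (state A B E d x0 u k))"
proof -
  let ?S = "\<lambda>u. \<Sum>k=0..N. residual k (state A B E d x0 u k) (u k)"
  have nonneg: "0 \<le> ?S u" for u
    by (intro sum_nonneg residual_nonneg) simp
  have zero: "?S u = 0 \<longleftrightarrow> (\<forall>k\<le>N. u k = feedback k (state A B E d x0 u k))" for u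
    by (subst sum_nonneg_eq_0_iff) (auto simp: residual_nonneg residual_eq_0_iff)
  obtain v where "v \<in> controls N" "?S v = 0"
    using optimal_feedback_exists zero by blast
  then have "(\<forall>w. w \<in> controls N \<longrightarrow> ?S u \<le> ?S w) \<longleftrightarrow> ?S u = 0"
    using nonneg by (metis order_antisym)
  then show ?thesis
    by (simp add: is_arg_min_linorder J_completed_squares zero)
qed

lemma unique_minimizer: "\<exists>!u. is_arg_min (J x0) (\<lambda>u. u \<in> controls N) u"
proof -
  obtain u where "u \<in> controls N" "\<forall>k\<le>N. u k = feedback k (state A B E d x0 u k)"
    using optimal_feedback_exists by blast
  moreover have "v = u" if "v \<in> controls N" "\<forall>k\<le>N. v k = feedback k (state A B E d x0 v k)" for v
    using that calculation feedback_unique[of N v feedback A B E d x0 u]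
    unfolding controls_def by (intro PiE_ext) auto
  ultimately show ?thesis
    unfolding is_arg_min_iff_feedback by blast
qed

section \<open>Forward-backward equations\<close>

text \<open>With the affine ansatz for the co-state \<open>l\<close>, the stationarity expression is
  \<open>Y k *v (v - feedback k x)\<close>, and \<open>Y k\<close> is injective.\<close>

lemma stationarity_iff_feedback:
  assumes "k \<le> N" "l = P (Suc k) *v (A *v x + B *v v + E *v d k) + f (Suc k)"
  shows "0 = (transpose B ** R ** B) *v v + transpose B *v l + (transpose B ** R ** E) *v d k
    \<longleftrightarrow> v = feedback k x"
proof -
  have "(transpose B ** R ** B) *v v + transpose B *v l + (transpose B ** R ** E) *v d k
      = Y k *v v + (M k *v x + h k)"
    using assms by (simp add: Y_eq M_eq h_eq matrix_vector_simps algebra_simps)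
  also have "\<dots> = Y k *v (v - feedback k x)"
    by (simp add: feedback_def matrix_vector_simps pos_def_matrix_inv_vector[OF pd]
        \<open>k \<le> N\<close> algebra_simps)
  finally show ?thesis
    using pos_def_matrix_inv_vector(2)[OF pd[OF \<open>k \<le> N\<close>], of "v - feedback k x"]
    by (metis matrix_vector_mult_0_right right_minus_eq)
qed

text \<open>Symmetry of \<open>P (Suc k)\<close> turns \<open>transpose A ** P (Suc k) ** B\<close>
  into \<open>transpose (M k)\<close>; inserting the feedback then reproduces the recursions for
  \<open>P k\<close> and \<open>f k\<close>.\<close>

lemma costate_step:
  assumes "k \<le> N" "l = P (Suc k) *v (A *v x + B *v v + E *v d k) + f (Suc k)"
    and "v = feedback k x"
  shows "Q *v (x - r) + transpose A *v l = P k *v x + f k"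
proof -
  have "transpose (P (Suc k)) = P (Suc k)"
    using assms pd by (intro P_sym) auto
  then have "transpose (M k) = transpose A ** P (Suc k) ** B"
    using assms by (simp add: M_eq matrix_transpose_mul matrix_mul_assoc)
  then have eq: "transpose A *v (P (Suc k) *v (B *v v))
      = - ((transpose (M k) ** matrix_inv (Y k) ** M k) *v x)
        - (transpose (M k) ** matrix_inv (Y k)) *v h k"
    unfolding \<open>v = _\<close> feedback_def by (simp add: matrix_vector_simps algebra_simps)
  then show ?thesis
    using assms(1,2) by (simp add: eq P_eq f_eq matrix_vector_simps algebra_simps)
qed

lemma fbde_solution_exists:
  assumes "\<And>k. k \<le> N \<Longrightarrow> u k = feedback k (state A B E d x0 u k)"
  shows "\<exists>lam. fbde_solution N A B E Q R (P (Suc N)) r d x0 (state A B E d x0 u) u lam"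
proof
  let ?x = "state A B E d x0 u"
  \<comment> \<open>The co-state is defined by the claimed affine relation; the shift sends index -1
    to time 0.\<close>
  let ?lam = "\<lambda>i. P (nat (i + 1)) *v ?x (nat (i + 1)) + f (nat (i + 1))"
  have lam: "?lam (int k) = P (Suc k) *v ?x (Suc k) + f (Suc k)" for k
    by (simp add: nat_add_distrib del: state.simps)
  have lam': "?lam (int k - 1) = P k *v ?x k + f k" for k
    by simp
  show "fbde_solution N A B E Q R (P (Suc N)) r d x0 ?x u ?lam"
    unfolding fbde_solution_def lam lam'
    using assms stationarity_iff_feedback[OF _ refl] costate_step[OF _ refl]
    by (auto simp: fT_eq matrix_vector_mult_diff_distrib)
qed

text \<open>The terminal condition is the case \<open>Suc N\<close>. Going backward, the relation at
  \<open>Suc k\<close> and the dynamics give the ansatz, stationarity forces the feedback, and the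
  adjoint equation gives the relation at \<open>k\<close>.\<close>

lemma fbde_costate:
  assumes sol: "fbde_solution N A B E Q R (P (Suc N)) r d x0 x u lam"
  shows "k \<le> Suc N \<Longrightarrow> lam (int k - 1) = P k *v x k + f k"
proof (induction k rule: inc_induct)
  case base
  show ?case
    using sol by (simp add: fbde_solution_def fT_eq matrix_vector_mult_diff_distrib)
next
  case (step k)
  have "x (Suc k) = A *v x k + B *v u k + E *v d k"
    using sol step by (simp add: fbde_solution_def)
  then have l: "lam (int k) = P (Suc k) *v (A *v x k + B *v u k + E *v d k) + f (Suc k)"
    using step by simp
  moreover have "k \<le> N" "k \<in> {0..N}"
    using step by simp_all
  ultimately have "u k = feedback k (x k)"
    using sol stationarity_iff_feedback unfolding fbde_solution_def by blast
  then show ?case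
    using sol step costate_step[OF _ l] by (simp add: fbde_solution_def)
qed

lemma fbde_feedback:
  assumes sol: "fbde_solution N A B E Q R (P (Suc N)) r d x0 x u lam" and k: "k \<le> N"
  shows "u k = feedback k (x k)"
proof -
  have "x (Suc k) = A *v x k + B *v u k + E *v d k"
    using sol k by (simp add: fbde_solution_def)
  then have l: "lam (int k) = P (Suc k) *v (A *v x k + B *v u k + E *v d k) + f (Suc k)"
    using fbde_costate[OF sol, of "Suc k"] k by simp
  moreover have "k \<in> {0..N}"
    using k by simp
  ultimately show ?thesis
    using sol k stationarity_iff_feedback unfolding fbde_solution_def by blast
qed

lemma fbde_state:
  assumes sol: "fbde_solution N A B E Q R (P (Suc N)) r d x0 x u lam"
  shows "k \<le> Suc N \<Longrightarrow> x k = state A B E d x0 u k"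
proof (induction k)
  case 0
  then show ?case using sol by (simp add: fbde_solution_def)
next
  case (Suc k)
  then show ?case using sol by (simp add: fbde_solution_def)
qed

lemma fbde_solution_unique:
  assumes u: "\<And>k. k \<le> N \<Longrightarrow> u k = feedback k (state A B E d x0 u k)"
    and sol: "fbde_solution N A B E Q R (P (Suc N)) r d x0 x' u' lam"
  shows "\<forall>k\<le>Suc N. x' k = state A B E d x0 u k" "\<forall>k\<le>N. u' k = u k"
    "\<forall>k\<le>N. lam (int k - 1) = P k *v state A B E d x0 u k + f k"
proof -
  have "u' k = feedback k (state A B E d x0 u' k)" if "k \<le> N" for k
    using that fbde_feedback[OF sol] fbde_state[OF sol] by simp
  then show eq: "\<forall>k\<le>N. u' k = u k"
    using feedback_unique[of N u' feedback A B E d x0 u] u by blast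
  have "state A B E d x0 u' k = state A B E d x0 u k" if "k \<le> Suc N" for k
    using that eq by (intro state_cong) auto
  then show x: "\<forall>k\<le>Suc N. x' k = state A B E d x0 u k"
    using fbde_state[OF sol] by simp
  show "\<forall>k\<le>N. lam (int k - 1) = P k *v state A B E d x0 u k + f k"
    using fbde_costate[OF sol] x by simp
qed

end

end

section \<open>Necessity of definite pivots\<close>

context riccati
begin

text \<open>The witness is the impulse \<open>w\<close> at time \<open>k\<close>, followed by the optimal feedback
  of the homogeneous problem: all squares after time \<open>k\<close> vanish.\<close>

lemma impulse_cost:
  assumes k: "k \<le> N" and pd: "\<And>j. k < j \<Longrightarrow> j \<le> N \<Longrightarrow> pos_def (Y j)"
  shows "\<exists>v. v k = w \<and> cost N A B E Q R (P (Suc N)) 0 (\<lambda>_. 0) 0 v = w \<bullet> (Y k *v w)"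
proof -
  interpret hom: lq_tracking A B Q R N P Y M E 0 "\<lambda>_. 0" "\<lambda>_. 0" "\<lambda>_. 0"
    by unfold_locales simp_all
  obtain v where v: "\<And>j. v j = (if j < k then 0 else if j = k then w else
      hom.feedback j (state A B E (\<lambda>_. 0) 0 v j))"
    using state_feedback_exists[of "\<lambda>j x. if j < k then 0 else if j = k then w else hom.feedback j x"]
    by metis
  let ?x = "state A B E (\<lambda>_. 0) 0 v"
  \<comment> \<open>The control vanishes before \<open>k\<close>, so the system is still at rest
    when the impulse arrives.\<close>
  have x0: "?x j = 0" if "j \<le> k" for j
    using that by (induction j) (simp_all add: v)
  have vk: "v k = w"
    by (simp add: v)
  have "(\<Sum>j=0..N. hom.stage j (?x j) (v j))
      = (\<Sum>j=0..<k. hom.stage j (?x j) (v j)) + hom.stage k (?x k) (v k)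
        + (\<Sum>j=Suc k..N. hom.stage j (?x j) (v j))"
  proof -
    have disj: "{0..<k} \<inter> {Suc k..N} = {}"
      by auto
    have "{0..N} = {0..<k} \<union> insert k {Suc k..N}"
      using k by auto
    then show ?thesis
      by (simp add: sum.union_disjoint disj)
  qed
  moreover have "(\<Sum>j=0..<k. hom.stage j (?x j) (v j)) = 0"
    by (rule sum.neutral) (simp add: hom.stage_def x0 v)
  moreover have "hom.stage k (?x k) (v k) = (B *v w) \<bullet> (R *v (B *v w))"
    by (simp add: hom.stage_def x0 vk)
  \<comment> \<open>The tail starts at \<open>Suc k\<close> because \<open>Y k\<close> is not yet
    known to be definite.\<close>
  moreover have "(\<Sum>j=Suc k..N. hom.stage j (?x j) (v j)) + hom.val (Suc N) (?x (Suc N))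
      = hom.val (Suc k) (?x (Suc k))"
  proof -
    have "hom.residual j (?x j) (v j) = 0" if "j > k" for j
      unfolding hom.residual_def using that v[of j] by simp
    then have "(\<Sum>j=Suc k..N. hom.offset j + hom.residual j (?x j) (v j)) = 0"
      by (intro sum.neutral) (simp add: hom.offset_def)
    then show ?thesis
      using hom.tail_cost[of "Suc k" 0 v] k pd by (simp del: state.simps)
  qed
  moreover have "hom.val (Suc k) (?x (Suc k)) = (B *v w) \<bullet> (P (Suc k) *v (B *v w))"
    by (simp add: hom.val_def x0 vk)
  ultimately have "cost N A B E Q R (P (Suc N)) 0 (\<lambda>_. 0) 0 v = w \<bullet> (Y k *v w)"
    unfolding hom.J_eq using k by (simp add: Y_eq matrix_vector_simps inner_add_right)
  then show ?thesis
    using vk by blast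
qed

text \<open>Backward induction: definiteness after \<open>k\<close> gives both the symmetry of
  \<open>P (Suc k)\<close>, hence of \<open>Y k\<close>, and the impulse control that tests
  \<open>Y k\<close>.\<close>

lemma unique_minimizer_imp_pos_def:
  assumes uniq: "\<exists>!u. is_arg_min (cost N A B E Q R (P (Suc N)) r d x0) (\<lambda>u. u \<in> controls N) u"
  shows "k \<le> N \<Longrightarrow> pos_def (Y k)"
proof (induction "N - k" arbitrary: k rule: less_induct)
  case less
  then have pd: "pos_def (Y j)" if "k < j" "j \<le> N" for j
    using that by simp
  have "transpose (P (Suc k)) = P (Suc k)"
    using less.prems pd by (intro P_sym) auto
  then have "transpose (Y k) = Y k"
    using less.prems
    by (simp add: Y_eq R_sym transpose_add matrix_transpose_mul matrix_mul_assoc)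
  moreover have "0 < w \<bullet> (Y k *v w)" if "w \<noteq> 0" for w
    using impulse_cost[OF less.prems pd, where w = w and E = E] that
      unique_minimizer_imp_homogeneous_cost_pos[OF uniq less.prems] by metis
  ultimately show ?case
    by (simp add: pos_def_def)
qed

end

section \<open>Assembly of the tracking theorem\<close>

theorem theorem1:
  fixes A :: "real^'n^'n" and B E :: "real^'m^'n" and c\<^sub>o :: "real^'n^'l"
    and Q R :: "real^'n^'n" and r x0 :: "real^'n"
    and N :: nat and d :: "nat \<Rightarrow> real^'m"
    and P :: "nat \<Rightarrow> real^'n^'n" and \<Upsilon> :: "nat \<Rightarrow> real^'m^'m" and M :: "nat \<Rightarrow> real^'n^'m"
    and h :: "nat \<Rightarrow> real^'m" and f :: "nat \<Rightarrow> real^'n"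
  assumes "Q = transpose c\<^sub>o ** c\<^sub>o"
    and "pos_semidef R"
    and "pos_semidef (P (N + 1))"
    and "\<And>k. k \<in> {0..N} \<Longrightarrow> \<Upsilon> k = transpose B ** (R + P (k + 1)) ** B"
    and "\<And>k. k \<in> {0..N} \<Longrightarrow> M k = transpose B ** P (k + 1) ** A"
    and "\<And>k. k \<in> {0..N} \<Longrightarrow>
           P k = Q + transpose A ** P (k + 1) ** A - transpose (M k) ** matrix_inv (\<Upsilon> k) ** M k"
    and "f (N + 1) = - (P (N + 1) *v r)"
    and "\<And>k. k \<in> {0..N} \<Longrightarrow>
           h k = (transpose B ** (R + P (k + 1)) ** E) *v d k + transpose B *v f (k + 1)"
    and "\<And>k. k \<in> {0..N} \<Longrightarrow>
           f k = (transpose A ** P (k + 1) ** E) *v d k + transpose A *v f (k + 1)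
                 - (transpose (M k) ** matrix_inv (\<Upsilon> k)) *v h k - Q *v r"
  shows
    "((\<exists>!u. is_arg_min (cost N A B E Q R (P (N + 1)) r d x0) (\<lambda>u. u \<in> controls N) u)
        \<longleftrightarrow> (\<forall>k\<in>{0..N}. pos_def (\<Upsilon> k)))
     \<and> ((\<forall>k\<in>{0..N}. pos_def (\<Upsilon> k)) \<longrightarrow>
        (\<forall>u. is_arg_min (cost N A B E Q R (P (N + 1)) r d x0) (\<lambda>u. u \<in> controls N) u \<longrightarrow>
          (let x = state A B E d x0 u in
            (\<forall>k\<in>{0..N}. u k = - ((matrix_inv (\<Upsilon> k) ** M k) *v x k) - matrix_inv (\<Upsilon> k) *v h k)
          \<and> cost N A B E Q R (P (N + 1)) r d x0 u =
              x0 \<bullet> (P 0 *v x0) + 2 * (x0 \<bullet> f 0) + r \<bullet> (P (N + 1) *v r)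
              + (\<Sum>k=0..N. r \<bullet> (Q *v r)
                   + d k \<bullet> ((transpose E ** (R + P (k + 1)) ** E) *v d k)
                   + 2 * (d k \<bullet> (transpose E *v f (k + 1)))
                   - h k \<bullet> (matrix_inv (\<Upsilon> k) *v h k))
          \<and> (\<exists>lam. fbde_solution N A B E Q R (P (N + 1)) r d x0 x u lam)
          \<and> (\<forall>x' u' lam. fbde_solution N A B E Q R (P (N + 1)) r d x0 x' u' lam \<longrightarrow>
                (\<forall>k\<in>{0..N + 1}. x' k = x k) \<and> (\<forall>k\<in>{0..N}. u' k = u k)
              \<and> (\<forall>k\<in>{0..N}. lam (int k - 1) = P k *v x k + f k)))))"
proof -
  interpret lq_tracking A B Q R N P \<Upsilon> M E r d h f
    using assms
    by unfold_locales (simp_all add: pos_semidef_def matrix_transpose_mul)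
  have iff: "(\<exists>!u. is_arg_min (J x0) (\<lambda>u. u \<in> controls N) u) \<longleftrightarrow> (\<forall>k\<in>{0..N}. pos_def (\<Upsilon> k))"
    using unique_minimizer unique_minimizer_imp_pos_def by (metis atLeastAtMost_iff le0)
  have opt: "(\<forall>k\<in>{0..N}. u k = - ((matrix_inv (\<Upsilon> k) ** M k) *v state A B E d x0 u k)
            - matrix_inv (\<Upsilon> k) *v h k)
      \<and> J x0 u = x0 \<bullet> (P 0 *v x0) + 2 * (x0 \<bullet> f 0) + r \<bullet> (P (Suc N) *v r) + (\<Sum>k=0..N. offset k)
      \<and> (\<exists>lam. fbde_solution N A B E Q R (P (Suc N)) r d x0 (state A B E d x0 u) u lam)
      \<and> (\<forall>x' u' lam. fbde_solution N A B E Q R (P (Suc N)) r d x0 x' u' lam \<longrightarrow>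
            (\<forall>k\<in>{0..Suc N}. x' k = state A B E d x0 u k) \<and> (\<forall>k\<in>{0..N}. u' k = u k)
          \<and> (\<forall>k\<in>{0..N}. lam (int k - 1) = P k *v state A B E d x0 u k + f k))"
    if pd: "\<forall>k\<in>{0..N}. pos_def (\<Upsilon> k)" and u: "is_arg_min (J x0) (\<lambda>u. u \<in> controls N) u" for u
  proof -
    have pd': "pos_def (\<Upsilon> k)" if "k \<le> N" for k
      using pd that by simp
    have fb: "u k = feedback k (state A B E d x0 u k)" if "k \<le> N" for k
      using u that by (simp add: is_arg_min_iff_feedback[OF pd'])
    \<comment> \<open>Along the optimal feedback every square vanishes, so the cost is its
      control-independent part.\<close>
    have "(\<Sum>k=0..N. residual k (state A B E d x0 u k) (u k)) = 0"
      using fb residual_eq_0_iff[OF pd'] by (intro sum.neutral) simp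
    then have "J x0 u = x0 \<bullet> (P 0 *v x0) + 2 * (x0 \<bullet> f 0) + r \<bullet> (P (Suc N) *v r)
        + (\<Sum>k=0..N. offset k)"
      by (simp add: J_completed_squares[OF pd'])
    moreover have "\<forall>k\<in>{0..N}. u k = - ((matrix_inv (\<Upsilon> k) ** M k) *v state A B E d x0 u k)
        - matrix_inv (\<Upsilon> k) *v h k"
      using fb by (simp add: feedback_def matrix_vector_simps)
    ultimately show ?thesis
      using fbde_solution_exists[OF pd' fb] fbde_solution_unique[OF pd' fb] by simp
  qed
  show ?thesis
    using iff opt unfolding Let_def offset_def Suc_eq_plus1 by blast
qed

end
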